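(* Let $(X,T)$ be a t.d.s. Then the following are equivalent: (1) $(X,T)$ is weakly mixing; (2) $(X,T)$ is $\mathcal{F}_{\inf}$-independent of order $2$; (3) $(X,T)$ is $\mathcal{F}_{\inf}$-independent; (4) $(X,T)$ is $\mathcal{F}_{\mathrm{ip}}$-independent of order $2$; (5) $(X,T)$ is $\mathcal{F}_{\mathrm{ip}}$-independent.
   Context: $\mathbb{Z}_+=\{0,1,2,\dots\}$, $\mathbb{N}=\{1,2,\dots\}$. A t.d.s. $(X,T)$ is a (nonempty) compact metrizable space $X$ with a surjective continuous map $T:X\to X$. For $U,V\subseteq X$, $N(U,V)=\{n\in\mathbb{Z}_+: U\cap T^{-n}V\neq\emptyset\}$. $(X,T)$ is (topologically) transitive if $N(U,V)\neq\emptyset$ for all nonempty open $U,V\subseteq X$; it is weakly mixing if $(X\times X,T\times T)$ is transitive. A set $F\subseteq\mathbb{Z}_+$ is an independence set for a tuple $(A_1,\dots,A_k)$ of subsets of $X$ if for every nonempty finite $J\subseteq F$ and every $s\in\{1,\dots,k\}^J$ one has $\bigcap_{j\in J}T^{-j}A_{s(j)}\neq\emptyset$. $\mathrm{Ind}(A_1,\dots,A_k)$ denotes the collection of all independence sets of $(A_1,\dots,A_k)$. A family is an upward-hereditary collection of subsets of $\mathbb{Z}_+$. For a family $\mathcal{F}$ and $k\in\mathbb{N}$, $(X,T)$ is $\mathcal{F}$-independent of order $k$ if $\mathrm{Ind}(U_1,\dots,U_k)\cap\mathcal{F}\neq\emptyset$ for all nonempty open subsets $U_1,\dots,U_k$ of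 $X$; it is $\mathcal{F}$-independent if it is $\mathcal{F}$-independent of order $k$ for every $k\in\mathbb{N}$. $\mathcal{F}_{\inf}$ is the family of all infinite subsets of $\mathbb{Z}_+$. An IP-set is a set of the form $\{a_{n_1}+\dots+a_{n_k}: k\in\mathbb{N},\ n_1<\dots<n_k\}$ for some sequence $\{a_n\}_{n\in\mathbb{N}}$ in $\mathbb{N}$; $\mathcal{F}_{\mathrm{ip}}$ is the family of all subsets of $\mathbb{Z}_+$ containing an IP-set. *)

theory Defs
  imports "HOL-Analysis.Analysis"
begin

definition tds :: "'a topology \<Rightarrow> ('a \<Rightarrow> 'a) \<Rightarrow> bool" where
  "tds X T \<longleftrightarrow>
     topspace X \<noteq> {} \<and> compact_space X \<and> metrizable_space X \<and>
     continuous_map X X T \<and> T ` topspace X = topspace X"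

text \<open>The preimage of \<open>A\<close> under the \<open>n\<close>-th iterate of \<open>T\<close>, taken inside the carrier of \<open>X\<close>
  (the values of \<open>T\<close> off the carrier are irrelevant).\<close>

definition iter_preimage :: "'a topology \<Rightarrow> ('a \<Rightarrow> 'a) \<Rightarrow> nat \<Rightarrow> 'a set \<Rightarrow> 'a set" where
  "iter_preimage X T n A = {x \<in> topspace X. (T ^^ n) x \<in> A}"

definition hitting_times :: "'a topology \<Rightarrow> ('a \<Rightarrow> 'a) \<Rightarrow> 'a set \<Rightarrow> 'a set \<Rightarrow> nat set" where
  "hitting_times X T U V = {n. U \<inter> iter_preimage X T n V \<noteq> {}}"

definition top_transitive :: "'a topology \<Rightarrow> ('a \<Rightarrow> 'a) \<Rightarrow> bool" where
  "top_transitive X T \<longleftrightarrow>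
     (\<forall>U V. openin X U \<and> U \<noteq> {} \<and> openin X V \<and> V \<noteq> {} \<longrightarrow> hitting_times X T U V \<noteq> {})"

definition weakly_mixing :: "'a topology \<Rightarrow> ('a \<Rightarrow> 'a) \<Rightarrow> bool" where
  "weakly_mixing X T \<longleftrightarrow> top_transitive (prod_topology X X) (map_prod T T)"

text \<open>A tuple \<open>(A\<^sub>1, \<dots>, A\<^sub>k)\<close> is a function \<open>A\<close> of which only the values on \<open>{1..k}\<close> matter.\<close>

definition Ind :: "'a topology \<Rightarrow> ('a \<Rightarrow> 'a) \<Rightarrow> nat \<Rightarrow> (nat \<Rightarrow> 'a set) \<Rightarrow> nat set set" where
  "Ind X T k A =
     {F. \<forall>J. J \<subseteq> F \<and> finite J \<and> J \<noteq> {} \<longrightarrow>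
           (\<forall>s \<in> J \<rightarrow> {1..k}. (\<Inter>j\<in>J. iter_preimage X T j (A (s j))) \<noteq> {})}"

definition is_family :: "nat set set \<Rightarrow> bool" where
  "is_family \<F> \<longleftrightarrow> (\<forall>A B. A \<in> \<F> \<and> A \<subseteq> B \<longrightarrow> B \<in> \<F>)"

definition independent_of_order ::
    "nat set set \<Rightarrow> nat \<Rightarrow> 'a topology \<Rightarrow> ('a \<Rightarrow> 'a) \<Rightarrow> bool" where
  "independent_of_order \<F> k X T \<longleftrightarrow>
     (\<forall>U. (\<forall>i\<in>{1..k}. openin X (U i) \<and> U i \<noteq> {}) \<longrightarrow> Ind X T k U \<inter> \<F> \<noteq> {})"

definition family_independent :: "nat set set \<Rightarrow> 'a topology \<Rightarrow> ('a \<Rightarrow> 'a) \<Rightarrow> bool" where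
  "family_independent \<F> X T \<longleftrightarrow> (\<forall>k\<ge>1. independent_of_order \<F> k X T)"

definition F_inf :: "nat set set" where
  "F_inf = {F. infinite F}"

text \<open>Sums over increasing tuples \<open>n\<^sub>1 < \<dots> < n\<^sub>k\<close> with \<open>k \<ge> 1\<close> are sums over finite nonempty
  index sets; the sequence is indexed from \<open>0\<close>.\<close>

definition is_IP_set :: "nat set \<Rightarrow> bool" where
  "is_IP_set P \<longleftrightarrow>
     (\<exists>a :: nat \<Rightarrow> nat. (\<forall>n. a n \<ge> 1) \<and> P = {\<Sum>i\<in>I. a i | I. finite I \<and> I \<noteq> {}})"

definition F_ip :: "nat set set" where
  "F_ip = {F. \<exists>P. is_IP_set P \<and> P \<subseteq> F}"

lemma is_family_F_inf: "is_family F_inf"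
  unfolding is_family_def F_inf_def by (auto dest: finite_subset)

lemma is_family_F_ip: "is_family F_ip"
  unfolding is_family_def F_ip_def by blast

end

theory Submission
  imports Defs
begin

text \<open>
  Write \<open>N(U,V)\<close> for \<open>hitting_times X T U V\<close>. Everything rests on one arithmetic remark: composing
  hitting sets with preimages turns simultaneous hitting of several pairs into hitting of a
  single pair of smaller open sets.

  From independence to weak mixing: if \<open>m < n\<close> are elements of an independence set for \<open>(U,V)\<close>,
  then \<open>n - m\<close> lies in \<open>N(U,U) \<inter> N(U,V)\<close>, because the entries of the tuple prescribed at the
  times \<open>m\<close> and \<open>n\<close> are arbitrary. That these two hitting sets always meet is Petersen's
  criterion for weak mixing (\<open>weakly_mixing_if_self_hitting\<close>).

  From weak mixing to independence, Furstenberg's intersection lemma says that the sets \<open>N(U,V)\<close>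
  form a filter base (\<open>weakly_mixing_hitting_filter_base\<close>), so that finitely many pairs are hit at
  a common positive time. If \<open>G\<close> is a finite independence set, each pattern \<open>s\<close> on \<open>G\<close> is realised on
  a nonempty open set \<open>W s\<close>; a common time \<open>a\<close> at which every \<open>W s\<close> hits every \<open>W t\<close> makes
  \<open>G \<union> (a + G)\<close> an independence set, the patterns on \<open>G\<close> and on \<open>a + G\<close> being realised independently
  (\<open>weakly_mixing_extend_Ind\<close>). Starting at \<open>{0}\<close> and iterating, the \<open>n\<close>-th set consists of the
  subset sums of the first \<open>n\<close> chosen times, so the union contains the IP-set they generate. As
  independence is a condition on finite subsets, the union is again an independence set. Finally
  IP-sets are infinite, which places the infinite versions between the IP versions and weak mixing.
\<close>

section \<open>Hitting times and weak mixing\<close>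

lemma mem_hitting_times_iff:
  assumes "openin X U"
  shows "n \<in> hitting_times X T U V \<longleftrightarrow> (\<exists>x\<in>U. (T ^^ n) x \<in> V)"
  using openin_subset[OF assms] by (auto simp: hitting_times_def iter_preimage_def)

lemma map_prod_funpow:
  fixes f :: "'a \<Rightarrow> 'a" and g :: "'b \<Rightarrow> 'b"
  shows "map_prod f g ^^ n = map_prod (f ^^ n) (g ^^ n)"
  by (induction n) (auto simp: fun_eq_iff)

text \<open>Transitivity of the product need only be tested on boxes, which form a base of the
  product topology.\<close>

lemma weakly_mixing_iff:
  "weakly_mixing X T \<longleftrightarrow>
     (\<forall>U U' V V'. openin X U \<and> U \<noteq> {} \<and> openin X U' \<and> U' \<noteq> {} \<and>
        openin X V \<and> V \<noteq> {} \<and> openin X V' \<and> V' \<noteq> {} \<longrightarrow>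
        hitting_times X T U V \<inter> hitting_times X T U' V' \<noteq> {})"
    (is "?L \<longleftrightarrow> ?R")
proof
  assume ?L
  show ?R
  proof (intro allI impI, elim conjE)
    fix U U' V V'
    assume op: "openin X U" "openin X U'" "openin X V" "openin X V'"
      and ne: "U \<noteq> {}" "U' \<noteq> {}" "V \<noteq> {}" "V' \<noteq> {}"
    have box: "openin (prod_topology X X) (U \<times> U')" "openin (prod_topology X X) (V \<times> V')"
      using op by (auto simp: openin_prod_Times_iff)
    then have "hitting_times (prod_topology X X) (map_prod T T) (U \<times> U') (V \<times> V') \<noteq> {}"
      using \<open>?L\<close> ne unfolding weakly_mixing_def top_transitive_def by blast
    then obtain n where "n \<in> hitting_times (prod_topology X X) (map_prod T T) (U \<times> U') (V \<times> V')"
      by blast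
    then have "n \<in> hitting_times X T U V \<inter> hitting_times X T U' V'"
      using op box by (auto simp: mem_hitting_times_iff map_prod_funpow)
    then show "hitting_times X T U V \<inter> hitting_times X T U' V' \<noteq> {}"
      by blast
  qed
next
  assume R: ?R
  show ?L
    unfolding weakly_mixing_def top_transitive_def
  proof (intro allI impI, elim conjE)
    fix P Q
    assume P: "openin (prod_topology X X) P" "P \<noteq> {}" and Q: "openin (prod_topology X X) Q" "Q \<noteq> {}"
    have box: "\<exists>A B. openin X A \<and> openin X B \<and> A \<noteq> {} \<and> B \<noteq> {} \<and> A \<times> B \<subseteq> W"
      if W: "openin (prod_topology X X) W" "W \<noteq> {}" for W
    proof -
      obtain x y where "(x, y) \<in> W"
        using W(2) by auto
      then obtain A B where "openin X A" "openin X B" "x \<in> A" "y \<in> B" "A \<times> B \<subseteq> W"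
        using W(1) unfolding openin_prod_topology_alt by metis
      then show ?thesis
        by blast
    qed
    obtain U U' where U: "openin X U" "openin X U'" "U \<noteq> {}" "U' \<noteq> {}" "U \<times> U' \<subseteq> P"
      using box[OF P] by blast
    obtain V V' where V: "openin X V" "openin X V'" "V \<noteq> {}" "V' \<noteq> {}" "V \<times> V' \<subseteq> Q"
      using box[OF Q] by blast
    obtain n where "n \<in> hitting_times X T U V \<inter> hitting_times X T U' V'"
      using R[rule_format, of U U' V V'] U V by auto
    then obtain x y where "x \<in> U" "(T ^^ n) x \<in> V" "y \<in> U'" "(T ^^ n) y \<in> V'"
      using U V by (auto simp: mem_hitting_times_iff)
    then have "n \<in> hitting_times (prod_topology X X) (map_prod T T) P Q"
      using U(5) V(5) unfolding mem_hitting_times_iff[OF P(1)]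
      by (intro bexI[of _ "(x, y)"]) (auto simp: map_prod_funpow)
    then show "hitting_times (prod_topology X X) (map_prod T T) P Q \<noteq> {}"
      by blast
  qed
qed

lemma weakly_mixing_common_time:
  assumes "weakly_mixing X T" "openin X U" "U \<noteq> {}" "openin X U'" "U' \<noteq> {}"
    "openin X V" "V \<noteq> {}" "openin X V'" "V' \<noteq> {}"
  obtains n where "n \<in> hitting_times X T U V" "n \<in> hitting_times X T U' V'"
proof -
  have "hitting_times X T U V \<inter> hitting_times X T U' V' \<noteq> {}"
    using assms(1)[unfolded weakly_mixing_iff, rule_format, of U U' V V'] assms(2-) by simp
  then show ?thesis
    using that by blast
qed

text \<open>Continuity keeps preimages of open sets open and surjectivity keeps them nonempty, so an
  iterated preimage may serve as a new target or source.\<close>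

locale surjective_system =
  fixes X :: "'a topology" and T :: "'a \<Rightarrow> 'a"
  assumes continuous: "continuous_map X X T"
    and surjective: "T ` topspace X = topspace X"
begin

lemma continuous_map_funpow: "continuous_map X X (T ^^ n)"
proof (induction n)
  case 0
  then show ?case by simp
next
  case (Suc n)
  then show ?case
    using continuous_map_compose[OF Suc continuous] by (simp only: funpow.simps)
qed

lemma funpow_image_topspace: "(T ^^ n) ` topspace X = topspace X"
proof (induction n)
  case (Suc n)
  then show ?case
    using surjective by (simp only: funpow.simps image_comp[symmetric])
qed simp

lemma openin_iter_preimage: "openin X V \<Longrightarrow> openin X (iter_preimage X T n V)"
  unfolding iter_preimage_def
  by (rule openin_continuous_map_preimage[OF continuous_map_funpow])

lemma iter_preimage_nonempty:
  assumes "openin X V" "V \<noteq> {}"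
  shows "iter_preimage X T n V \<noteq> {}"
proof -
  obtain y where "y \<in> V" "y \<in> (T ^^ n) ` topspace X"
    using assms(2) openin_subset[OF assms(1)] funpow_image_topspace[of n] by auto
  then show ?thesis
    by (auto simp: iter_preimage_def)
qed

text \<open>Petersen's criterion. Both steps replace the source set by a smaller one that already
  controls a second pair after a shift in time: the first passes from the pairs
  \<open>(U,U)\<close>, \<open>(U,V)\<close> to two arbitrary targets, the second to two arbitrary sources.\<close>

lemma weakly_mixing_if_self_hitting:
  assumes self: "\<And>U V. openin X U \<Longrightarrow> U \<noteq> {} \<Longrightarrow> openin X V \<Longrightarrow> V \<noteq> {} \<Longrightarrow>
     hitting_times X T U U \<inter> hitting_times X T U V \<noteq> {}"
  shows "weakly_mixing X T"
proof -
  have small: "\<exists>n. openin X (U \<inter> iter_preimage X T n V) \<and> U \<inter> iter_preimage X T n V \<noteq> {}"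
    if "openin X U" "U \<noteq> {}" "openin X V" "V \<noteq> {}" for U V
    using self[OF that] that(1,3) by (auto simp: hitting_times_def openin_iter_preimage openin_Int)
  have targets: "hitting_times X T U V \<inter> hitting_times X T U V' \<noteq> {}"
    if U: "openin X U" "U \<noteq> {}" and V: "openin X V" "V \<noteq> {}" and V': "openin X V'" "V' \<noteq> {}"
    for U V V'
  proof -
    obtain m where m: "openin X (U \<inter> iter_preimage X T m V)" "U \<inter> iter_preimage X T m V \<noteq> {}"
      using small[OF U V] by blast
    define W where "W = U \<inter> iter_preimage X T m V"
    obtain k where
      "k \<in> hitting_times X T W W \<inter> hitting_times X T W (iter_preimage X T m V')"
      using self[OF m openin_iter_preimage[OF V'(1)] iter_preimage_nonempty[OF V']]
      unfolding W_def by blast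
    then have "m + k \<in> hitting_times X T U V \<inter> hitting_times X T U V'"
      unfolding W_def using m(1) U(1)
      by (auto simp: mem_hitting_times_iff iter_preimage_def funpow_add)
    then show ?thesis
      by blast
  qed
  show ?thesis
    unfolding weakly_mixing_iff
  proof (intro allI impI, elim conjE)
    fix U U' V V'
    assume U: "openin X U" "U \<noteq> {}" and U': "openin X U'" "U' \<noteq> {}"
      and V: "openin X V" "V \<noteq> {}" and V': "openin X V'" "V' \<noteq> {}"
    obtain n where n: "openin X (U \<inter> iter_preimage X T n U')" "U \<inter> iter_preimage X T n U' \<noteq> {}"
      using small[OF U U'] by blast
    define W where "W = U \<inter> iter_preimage X T n U'"
    obtain k where "k \<in> hitting_times X T W V \<inter> hitting_times X T W (iter_preimage X T n V')"
      using targets[OF n V openin_iter_preimage[OF V'(1)] iter_preimage_nonempty[OF V']]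
      unfolding W_def by blast
    then obtain x y where x: "x \<in> U" "(T ^^ k) x \<in> V"
      and y: "(T ^^ n) y \<in> U'" "(T ^^ (n + k)) y \<in> V'"
      unfolding W_def using n(1)
      by (auto simp: mem_hitting_times_iff iter_preimage_def funpow_add)
    have "(T ^^ k) ((T ^^ n) y) \<in> V'"
      using y(2) by (metis add.commute comp_apply funpow_add)
    then have "k \<in> hitting_times X T U V \<inter> hitting_times X T U' V'"
      using x y(1) U(1) U'(1) by (auto simp: mem_hitting_times_iff)
    then show "hitting_times X T U V \<inter> hitting_times X T U' V' \<noteq> {}"
      by blast
  qed
qed

text \<open>Furstenberg's intersection lemma, by induction on the number of pairs. For two pairs, weak mixing supplies one time \<open>n\<close> that
  moves \<open>U\<close> into \<open>U'\<close> and \<open>V\<close> into \<open>V'\<close>; a point going from \<open>U \<inter> T\<^sup>-\<^sup>n U'\<close> to \<open>V \<inter> T\<^sup>-\<^sup>n V'\<close>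
  then witnesses the second pair through its image under the \<open>n\<close>-th iterate.\<close>

lemma weakly_mixing_hitting_filter_base:
  assumes wm: "weakly_mixing X T" and "finite I"
    and "\<And>i. i \<in> I \<Longrightarrow> openin X (U i) \<and> U i \<noteq> {} \<and> openin X (V i) \<and> V i \<noteq> {}"
    and "topspace X \<noteq> {}"
  shows "\<exists>A B. openin X A \<and> A \<noteq> {} \<and> openin X B \<and> B \<noteq> {} \<and>
           (\<forall>i\<in>I. hitting_times X T A B \<subseteq> hitting_times X T (U i) (V i))"
  using assms(2,3)
proof (induction I rule: finite_induct)
  case empty
  then show ?case
    using \<open>topspace X \<noteq> {}\<close> openin_topspace by blast
next
  case (insert i I)
  then obtain A B where A: "openin X A" "A \<noteq> {}" and B: "openin X B" "B \<noteq> {}"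
    and sub: "\<forall>i\<in>I. hitting_times X T A B \<subseteq> hitting_times X T (U i) (V i)"
    by blast
  have i: "openin X (U i)" "U i \<noteq> {}" "openin X (V i)" "V i \<noteq> {}"
    using insert.prems by auto
  obtain n where n: "n \<in> hitting_times X T A (U i)" "n \<in> hitting_times X T B (V i)"
    using wm A B i by (elim weakly_mixing_common_time)
  define A' where "A' = A \<inter> iter_preimage X T n (U i)"
  define B' where "B' = B \<inter> iter_preimage X T n (V i)"
  have A': "openin X A'" "A' \<noteq> {}" and B': "openin X B'" "B' \<noteq> {}"
    using n A B i by (auto simp: A'_def B'_def hitting_times_def openin_iter_preimage openin_Int)
  have old: "hitting_times X T A' B' \<subseteq> hitting_times X T A B"
    using A(1) A'(1) by (auto simp: mem_hitting_times_iff A'_def B'_def)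
  have new: "hitting_times X T A' B' \<subseteq> hitting_times X T (U i) (V i)"
  proof
    fix k assume "k \<in> hitting_times X T A' B'"
    then obtain x where x: "x \<in> A'" "(T ^^ k) x \<in> B'"
      using A'(1) by (auto simp: mem_hitting_times_iff)
    then have "(T ^^ n) x \<in> U i" "(T ^^ n) ((T ^^ k) x) \<in> V i"
      by (auto simp: A'_def B'_def iter_preimage_def)
    moreover have "(T ^^ n) ((T ^^ k) x) = (T ^^ k) ((T ^^ n) x)"
      by (metis add.commute comp_apply funpow_add)
    ultimately show "k \<in> hitting_times X T (U i) (V i)"
      using i(1) by (auto simp: mem_hitting_times_iff)
  qed
  show ?case
    using A' B' old new sub by (intro exI[of _ A'] exI[of _ B']) blast
qed

text \<open>The common time can be taken positive by aiming at the preimage of the target under one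
  application of the map.\<close>

lemma weakly_mixing_common_positive_time:
  assumes wm: "weakly_mixing X T" and fin: "finite I"
    and op: "\<And>i. i \<in> I \<Longrightarrow> openin X (U i) \<and> U i \<noteq> {} \<and> openin X (V i) \<and> V i \<noteq> {}"
    and "topspace X \<noteq> {}"
  shows "\<exists>a\<ge>1. \<forall>i\<in>I. a \<in> hitting_times X T (U i) (V i)"
proof -
  obtain A B where A: "openin X A" "A \<noteq> {}" and B: "openin X B" "B \<noteq> {}"
    and sub: "\<forall>i\<in>I. hitting_times X T A B \<subseteq> hitting_times X T (U i) (V i)"
    using weakly_mixing_hitting_filter_base[where U = U and V = V, OF assms] by auto
  obtain n where "n \<in> hitting_times X T A (iter_preimage X T 1 B)"
    using weakly_mixing_common_time[OF wm A A]
      openin_iter_preimage[OF B(1)] iter_preimage_nonempty[OF B] by metis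
  then have "Suc n \<in> hitting_times X T A B"
    using A(1) by (auto simp: mem_hitting_times_iff iter_preimage_def)
  then show ?thesis
    using sub by (intro exI[of _ "Suc n"]) (simp add: subset_iff)
qed

end

section \<open>Independence sets\<close>

lemma IndI:
  assumes "\<And>J s. J \<subseteq> F \<Longrightarrow> finite J \<Longrightarrow> J \<noteq> {} \<Longrightarrow> s \<in> J \<rightarrow> {1..k} \<Longrightarrow>
     (\<Inter>j\<in>J. iter_preimage X T j (A (s j))) \<noteq> {}"
  shows "F \<in> Ind X T k A"
  unfolding Ind_def mem_Collect_eq using assms by (intro allI impI ballI) simp

lemma IndD:
  assumes "F \<in> Ind X T k A" "J \<subseteq> F" "finite J" "J \<noteq> {}" "s \<in> J \<rightarrow> {1..k}"
  shows "(\<Inter>j\<in>J. iter_preimage X T j (A (s j))) \<noteq> {}"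
  using assms(1)[unfolded Ind_def mem_Collect_eq, rule_format, of J s] assms(2-) by simp

text \<open>For a nonempty tuple, a pattern on part of a finite set extends to the whole set, so only
  patterns on the whole set matter.\<close>

lemma finite_Ind_iff:
  assumes "finite G" "G \<noteq> {}" "k \<ge> 1"
  shows "G \<in> Ind X T k A \<longleftrightarrow>
     (\<forall>s \<in> G \<rightarrow> {1..k}. (\<Inter>j\<in>G. iter_preimage X T j (A (s j))) \<noteq> {})"
proof
  assume "G \<in> Ind X T k A"
  then show "\<forall>s \<in> G \<rightarrow> {1..k}. (\<Inter>j\<in>G. iter_preimage X T j (A (s j))) \<noteq> {}"
    using assms IndD[of G X T k A G] by simp
next
  assume R: "\<forall>s \<in> G \<rightarrow> {1..k}. (\<Inter>j\<in>G. iter_preimage X T j (A (s j))) \<noteq> {}"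
  have "(\<Inter>j\<in>J. iter_preimage X T j (A (s j))) \<noteq> {}"
    if J: "J \<subseteq> G" "J \<noteq> {}" and s: "s \<in> J \<rightarrow> {1..k}" for J s
  proof -
    define s' where "s' j = (if j \<in> J then s j else 1)" for j
    have "s' \<in> G \<rightarrow> {1..k}"
      using s \<open>k \<ge> 1\<close> by (auto simp: s'_def)
    with R have "(\<Inter>j\<in>G. iter_preimage X T j (A (s' j))) \<noteq> {}"
      by simp
    moreover have "(\<Inter>j\<in>G. iter_preimage X T j (A (s' j))) \<subseteq>
        (\<Inter>j\<in>J. iter_preimage X T j (A (s' j)))"
      using J(1) by (rule INF_superset_mono) simp
    moreover have "\<dots> = (\<Inter>j\<in>J. iter_preimage X T j (A (s j)))"
      by (simp add: s'_def)
    ultimately show ?thesis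
      by auto
  qed
  then show "G \<in> Ind X T k A"
    by (intro IndI)
qed

lemma Ind_incseq_Union:
  assumes "incseq G" "\<And>n. G n \<in> Ind X T k A"
  shows "(\<Union>n. G n) \<in> Ind X T k A"
proof -
  have fin: "\<exists>n. J \<subseteq> G n" if "finite J" "J \<subseteq> (\<Union>n. G n)" for J
    using that
  proof (induction J rule: finite_induct)
    case (insert j J)
    then obtain m n where "J \<subseteq> G m" "j \<in> G n"
      by auto
    then have "insert j J \<subseteq> G (max m n)"
      using incseqD[OF assms(1), of m "max m n"] incseqD[OF assms(1), of n "max m n"] by auto
    then show ?case ..
  qed simp
  show ?thesis
  proof (rule IndI)
    fix J s
    assume J: "J \<subseteq> (\<Union>n. G n)" "finite J" "J \<noteq> {}" and s: "s \<in> J \<rightarrow> {1..k}"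
    from fin[OF J(2,1)] obtain n where "J \<subseteq> G n" ..
    then show "(\<Inter>j\<in>J. iter_preimage X T j (A (s j))) \<noteq> {}"
      using IndD[OF assms(2)] J s by simp
  qed
qed

text \<open>Take a point that visits \<open>A p\<close> at time \<open>m\<close> and \<open>A q\<close> at time \<open>n\<close>: its image under the \<open>m\<close>-th
  iterate starts in \<open>A p\<close> and is in \<open>A q\<close> after \<open>n - m\<close> steps.\<close>

lemma diff_mem_hitting_times_if_Ind:
  assumes F: "F \<in> Ind X T k A" and mn: "m \<in> F" "n \<in> F" "m < n"
    and pq: "p \<in> {1..k}" "q \<in> {1..k}" and op: "openin X (A p)"
  shows "n - m \<in> hitting_times X T (A p) (A q)"
proof -
  define s where "s j = (if j = m then p else q)" for j :: nat
  have "s \<in> {m, n} \<rightarrow> {1..k}"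
    using pq by (auto simp: s_def)
  then have "(\<Inter>j\<in>{m, n}. iter_preimage X T j (A (s j))) \<noteq> {}"
    using mn by (intro IndD[OF F]) auto
  then obtain x where "(T ^^ m) x \<in> A p" "(T ^^ n) x \<in> A q"
    using mn(3) by (auto simp: s_def iter_preimage_def)
  moreover have "(T ^^ n) x = (T ^^ (n - m)) ((T ^^ m) x)"
    using mn(3) by (metis comp_apply funpow_add le_add_diff_inverse2 less_imp_le)
  ultimately show ?thesis
    using op by (auto simp: mem_hitting_times_iff)
qed

text \<open>The difference of two elements of an independence set for \<open>(U,V)\<close> is a common element of
  both hitting sets in Petersen's criterion.\<close>

lemma (in surjective_system) weakly_mixing_if_inf_independent:
  assumes ind: "independent_of_order F_inf 2 X T"
  shows "weakly_mixing X T"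
proof (rule weakly_mixing_if_self_hitting)
  fix U V
  assume U: "openin X U" "U \<noteq> {}" and V: "openin X V" "V \<noteq> {}"
  define A where "A i = (if i = 1 then U else V)" for i :: nat
  have "Ind X T 2 A \<inter> F_inf \<noteq> {}"
    using ind U V by (simp add: independent_of_order_def A_def)
  then obtain F where F: "F \<in> Ind X T 2 A" "infinite F"
    by (auto simp: F_inf_def)
  obtain m where m: "m \<in> F"
    using F(2) by fastforce
  obtain n where n: "n \<in> F" "m < n"
    using F(2) by (meson infinite_nat_iff_unbounded)
  have "n - m \<in> hitting_times X T (A 1) (A 1)" "n - m \<in> hitting_times X T (A 1) (A 2)"
    using diff_mem_hitting_times_if_Ind[OF F(1) m n, of 1 1]
      diff_mem_hitting_times_if_Ind[OF F(1) m n, of 1 2] U(1) by (simp_all add: A_def)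
  then show "hitting_times X T U U \<inter> hitting_times X T U V \<noteq> {}"
    by (auto simp: A_def)
qed

context surjective_system
begin

lemma singleton_0_Ind:
  assumes "\<And>i. i \<in> {1..k} \<Longrightarrow> openin X (A i) \<and> A i \<noteq> {}" "k \<ge> 1"
  shows "{0} \<in> Ind X T k A"
proof -
  have "iter_preimage X T 0 (A (s 0)) \<noteq> {}" if "s \<in> {0} \<rightarrow> {1..k}" for s :: "nat \<Rightarrow> nat"
    using that assms(1) iter_preimage_nonempty by blast
  then show ?thesis
    using assms(2) by (simp add: finite_Ind_iff)
qed

text \<open>A pattern on \<open>G \<union> (a + G)\<close> restricts to two patterns on \<open>G\<close>, and the open set of the first
  hits that of the second at time \<open>a\<close>. The sets \<open>G\<close> and \<open>a + G\<close> may overlap: the two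
  restrictions are then merely not arbitrary.\<close>

lemma weakly_mixing_extend_Ind:
  assumes wm: "weakly_mixing X T" and ne: "topspace X \<noteq> {}"
    and op: "\<And>i. i \<in> {1..k} \<Longrightarrow> openin X (A i)" and k: "k \<ge> 1"
    and G: "finite G" "G \<noteq> {}" "G \<in> Ind X T k A"
  shows "\<exists>a\<ge>1. G \<union> (+) a ` G \<in> Ind X T k A"
proof -
  define W where "W s = (\<Inter>j\<in>G. iter_preimage X T j (A (s j)))" for s :: "nat \<Rightarrow> nat"
  \<comment> \<open>Extensional patterns, so that there are finitely many of them.\<close>
  define S where "S = (G \<rightarrow>\<^sub>E {1..k})"
  have finS: "finite (S \<times> S)"
    using G(1) by (auto simp: S_def intro: finite_PiE)
  have Wop: "openin X (W s)" and Wne: "W s \<noteq> {}" if "s \<in> G \<rightarrow> {1..k}" for s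
  proof -
    show "openin X (W s)"
      unfolding W_def using that G(1,2) op
      by (intro openin_INT2 openin_iter_preimage) (blast dest: funcset_mem)+
    show "W s \<noteq> {}"
      unfolding W_def using that G finite_Ind_iff[OF G(1,2) k] by blast
  qed
  have "\<exists>a\<ge>1. \<forall>p\<in>S \<times> S. a \<in> hitting_times X T (W (fst p)) (W (snd p))"
    using Wop Wne by (intro weakly_mixing_common_positive_time[OF wm finS _ ne])
      (auto simp: S_def PiE_def)
  then obtain a where a: "a \<ge> 1" "\<And>s t. s \<in> S \<Longrightarrow> t \<in> S \<Longrightarrow> a \<in> hitting_times X T (W s) (W t)"
    by auto
  have "(\<Inter>j\<in>G \<union> (+) a ` G. iter_preimage X T j (A (s j))) \<noteq> {}"
    if s: "s \<in> G \<union> (+) a ` G \<rightarrow> {1..k}" for s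
  proof -
    let ?s = "restrict s G" and ?t = "restrict (\<lambda>j. s (a + j)) G"
    have st: "?s \<in> S" "?t \<in> S"
      using s by (auto simp: S_def)
    have "openin X (W ?s)"
      using Wop st by (auto simp: S_def)
    with a(2)[OF st] obtain x where x: "x \<in> W ?s" "(T ^^ a) x \<in> W ?t"
      by (auto simp: mem_hitting_times_iff)
    have "(T ^^ (a + j)) x = (T ^^ j) ((T ^^ a) x)" for j
      by (metis add.commute comp_apply funpow_add)
    moreover have "x \<in> topspace X"
      using x(1) G(2) by (auto simp: W_def iter_preimage_def)
    ultimately have "x \<in> (\<Inter>j\<in>G \<union> (+) a ` G. iter_preimage X T j (A (s j)))"
      using x by (auto simp: W_def iter_preimage_def)
    then show ?thesis
      by blast
  qed
  then have "G \<union> (+) a ` G \<in> Ind X T k A"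
    using G by (subst finite_Ind_iff[OF _ _ k]) auto
  with a(1) show ?thesis
    by blast
qed

text \<open>Adjoining the translate \<open>a + G\<close> to \<open>G\<close> is exactly how the set of subset sums grows when a
  generator \<open>a\<close> is added, so repeated extension from \<open>{0}\<close> builds an IP-set.\<close>

lemma weakly_mixing_imp_ip_independent:
  assumes wm: "weakly_mixing X T" and k: "k \<ge> 1"
  shows "independent_of_order F_ip k X T"
  unfolding independent_of_order_def
proof (intro allI impI)
  fix A :: "nat \<Rightarrow> 'a set"
  assume A: "\<forall>i\<in>{1..k}. openin X (A i) \<and> A i \<noteq> {}"
  have ne: "topspace X \<noteq> {}"
    using A k openin_subset[of X "A 1"] by auto
  define good where "good G \<longleftrightarrow> finite G \<and> G \<noteq> {} \<and> G \<in> Ind X T k A" for G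
  have "\<forall>G. \<exists>a. good G \<longrightarrow> a \<ge> 1 \<and> good (G \<union> (+) a ` G)"
    using weakly_mixing_extend_Ind[OF wm ne _ k, of A] A unfolding good_def
    by (metis finite_UnI finite_imageI Un_empty)
  then obtain g where g: "\<And>G. good G \<Longrightarrow> g G \<ge> 1 \<and> good (G \<union> (+) (g G) ` G)"
    by metis
  \<comment> \<open>\<open>G n\<close> collects all subset sums of the generators \<open>a 0, \<dots>, a (n - 1)\<close>, the empty sum included.\<close>
  define G where "G n = ((\<lambda>H. H \<union> (+) (g H) ` H) ^^ n) {0}" for n
  define a where "a n = g (G n)" for n
  have G_0: "G 0 = {0}" and G_Suc: "G (Suc n) = G n \<union> (+) (a n) ` G n" for n
    by (simp_all add: G_def a_def)
  have good: "good (G n)" for n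
  proof (induction n)
    case 0
    then show ?case
      using singleton_0_Ind[of k A] A k by (simp add: G_0 good_def)
  next
    case (Suc n)
    then show ?case
      using g unfolding G_Suc a_def by blast
  qed
  have a: "a n \<ge> 1" for n
    using g[OF good] by (simp add: a_def)
  have sums: "(\<Sum>i\<in>I. a i) \<in> G n" if "I \<subseteq> {..<n}" for I n
    using that
  proof (induction n arbitrary: I)
    case 0
    then show ?case
      by (simp add: G_0)
  next
    case (Suc n)
    have fin: "finite I"
      using Suc.prems finite_subset by blast
    have "I - {n} \<subseteq> {..<n}"
      using Suc.prems by (auto simp: less_Suc_eq)
    then have IH: "(\<Sum>i\<in>I - {n}. a i) \<in> G n"
      by (rule Suc.IH)
    show ?case
    proof (cases "n \<in> I")
      case True
      then show ?thesis
        using IH fin by (auto simp: G_Suc sum.remove)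
    next
      case False
      then show ?thesis
        using IH by (simp add: G_Suc)
    qed
  qed
  have "(\<Union>n. G n) \<in> Ind X T k A"
    using good by (intro Ind_incseq_Union incseq_SucI) (auto simp: G_Suc good_def)
  moreover have "{\<Sum>i\<in>I. a i | I. finite I \<and> I \<noteq> {}} \<subseteq> (\<Union>n. G n)"
  proof clarify
    fix I :: "nat set" assume "finite I"
    then obtain n where "I \<subseteq> {..<n}"
      using finite_nat_iff_bounded by blast
    then show "(\<Sum>i\<in>I. a i) \<in> (\<Union>n. G n)"
      using sums by blast
  qed
  then have "(\<Union>n. G n) \<in> F_ip"
    using a unfolding F_ip_def is_IP_set_def by blast
  ultimately show "Ind X T k A \<inter> F_ip \<noteq> {}"
    by blast
qed

end

section \<open>Comparison of the families\<close>

text \<open>The sum of the first \<open>n\<close> generators of an IP-set is at least \<open>n\<close>, so IP-sets are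
  unbounded.\<close>

lemma F_ip_subset_F_inf: "F_ip \<subseteq> F_inf"
proof
  fix F assume "F \<in> F_ip"
  then obtain a :: "nat \<Rightarrow> nat" where a: "\<And>n. a n \<ge> 1"
    and sub: "{\<Sum>i\<in>I. a i | I. finite I \<and> I \<noteq> {}} \<subseteq> F"
    unfolding F_ip_def is_IP_set_def by blast
  have "\<exists>n\<ge>m. n \<in> F" for m
  proof -
    have "(\<Sum>i\<le>m. a i) \<in> F"
      using sub by blast
    moreover have "m \<le> (\<Sum>i\<le>m. a i)"
      using sum_mono[of "{..m}" "\<lambda>_. 1" a] a by simp
    ultimately show ?thesis
      by blast
  qed
  then show "F \<in> F_inf"
    by (simp add: F_inf_def infinite_nat_iff_unbounded_le)
qed

lemma independent_of_order_mono:
  assumes "independent_of_order \<F> k X T" "\<F> \<subseteq> \<G>"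
  shows "independent_of_order \<G> k X T"
  using assms unfolding independent_of_order_def by blast

theorem theorem5p1:
  fixes X :: "'a topology" and T :: "'a \<Rightarrow> 'a"
  assumes "tds X T"
  shows "(weakly_mixing X T \<longleftrightarrow> independent_of_order F_inf 2 X T) \<and>
         (weakly_mixing X T \<longleftrightarrow> family_independent F_inf X T) \<and>
         (weakly_mixing X T \<longleftrightarrow> independent_of_order F_ip 2 X T) \<and>
         (weakly_mixing X T \<longleftrightarrow> family_independent F_ip X T)"
proof -
  interpret surjective_system X T
    using assms by unfold_locales (simp_all add: tds_def)
  have "family_independent F_ip X T" if "weakly_mixing X T"
    using that weakly_mixing_imp_ip_independent by (simp add: family_independent_def)
  moreover have order_2: "independent_of_order \<F> 2 X T" if "family_independent \<F> X T" for \<F>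
    using that by (simp add: family_independent_def)
  moreover have "family_independent F_inf X T" if "family_independent F_ip X T"
    using that independent_of_order_mono[OF _ F_ip_subset_F_inf]
    unfolding family_independent_def by blast
  moreover have "independent_of_order F_inf 2 X T" if "independent_of_order F_ip 2 X T"
    using that F_ip_subset_F_inf by (rule independent_of_order_mono)
  ultimately show ?thesis
    using weakly_mixing_if_inf_independent by blast
qed

end
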